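(* Let $A\in\mathbb{R}^{n\times n}$ be nonsingular. Then an $\omega$-optimal left-sided diagonal preconditioner, i.e. a matrix $C=\operatorname{Diag}(c)$ with $c$ a global minimizer of $$\min_{c\in\mathbb{R}^n_{++}}\ \omega\big((\operatorname{Diag}(c)^{1/2}A)^T\operatorname{Diag}(c)^{1/2}A\big),$$ is given by $C=\operatorname{Diag}(\operatorname{diag}(AA^T))^{-1}$.
   Context: For a symmetric positive definite $n\times n$ matrix $S$, $\omega(S)=\dfrac{\operatorname{trace}(S)/n}{\det(S)^{1/n}}$. $\operatorname{diag}(S)$ is the vector of diagonal entries of $S$, $\operatorname{Diag}(c)$ the diagonal matrix with diagonal $c$, and $\mathbb{R}^n_{++}$ the set of vectors with strictly positive entries. *)

theory Defs
  imports "HOL-Analysis.Analysis"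
begin

definition diag :: "real ^ 'n ^ 'n \<Rightarrow> real ^ 'n" where
  "diag S = (\<chi> i. S $ i $ i)"

definition Diag :: "real ^ 'n \<Rightarrow> real ^ 'n ^ 'n" where
  "Diag c = (\<chi> i j. if i = j then c $ i else 0)"

definition pos_vecs :: "(real ^ 'n) set" where
  "pos_vecs = {c. \<forall>i. 0 < c $ i}"

definition pos_semidef :: "real ^ 'n ^ 'n \<Rightarrow> bool" where
  "pos_semidef S \<longleftrightarrow> transpose S = S \<and> (\<forall>x. 0 \<le> x \<bullet> (S *v x))"

text \<open>The power \<open>S\<^sup>1\<^sup>/\<^sup>2\<close> is the principal square root; it is well defined on every
  matrix \<open>Diag c\<close> with \<open>c\<close> positive, where it is the entrywise root (lemma
  \<open>mat_sqrt_Diag\<close> below).\<close>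
definition mat_sqrt :: "real ^ 'n ^ 'n \<Rightarrow> real ^ 'n ^ 'n" where
  "mat_sqrt S = (THE R. pos_semidef R \<and> R ** R = S)"

text \<open>Only meaningful for symmetric positive definite \<open>S\<close>: \<open>powr\<close> is
  the ordinary real power because the determinant is then positive.\<close>
definition omega :: "real ^ 'n ^ 'n \<Rightarrow> real" where
  "omega S = (trace S / real CARD('n)) / (det S powr (1 / real CARD('n)))"

definition omega_left_objective :: "real ^ 'n ^ 'n \<Rightarrow> real ^ 'n \<Rightarrow> real" where
  "omega_left_objective A c =
     omega (transpose (mat_sqrt (Diag c) ** A) ** (mat_sqrt (Diag c) ** A))"

definition omega_optimal_left_diag_precond :: "real ^ 'n ^ 'n \<Rightarrow> real ^ 'n ^ 'n \<Rightarrow> bool" where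
  "omega_optimal_left_diag_precond A C \<longleftrightarrow>
     (\<exists>c. C = Diag c \<and> is_arg_min (omega_left_objective A) (\<lambda>c. c \<in> pos_vecs) c)"

lemma Diag_mult_vec: "Diag c *v x = (\<chi> i. c $ i * x $ i)"
  by (simp add: Diag_def matrix_vector_mult_def vec_eq_iff if_distrib[of "\<lambda>a. a * _"] cong: if_cong)

lemma Diag_mult_Diag: "Diag c ** Diag d = Diag (\<chi> i. c $ i * d $ i)"
  by (simp add: matrix_eq Diag_mult_vec vec_eq_iff mult.assoc flip: matrix_vector_mul_assoc)

lemma mat_sqrt_Diag:
  assumes "c \<in> pos_vecs"
  shows "mat_sqrt (Diag c) = Diag (\<chi> i. sqrt (c $ i))"
  unfolding mat_sqrt_def
proof (rule the_equality)
  have pos: "0 < c $ i" for i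
    using assms by (simp add: pos_vecs_def)
  let ?D = "Diag (\<chi> i. sqrt (c $ i))"
  have "transpose ?D = ?D"
    by (auto simp: Diag_def transpose_def vec_eq_iff)
  moreover have "0 \<le> x \<bullet> (?D *v x)" for x
    unfolding inner_vec_def Diag_mult_vec
    by (rule sum_nonneg) (use pos in \<open>simp add: less_imp_le mult.left_commute[of "x $ _"]\<close>)
  moreover have "?D ** ?D = Diag c"
    using pos by (simp add: Diag_mult_Diag less_imp_le)
  ultimately show "pos_semidef ?D \<and> ?D ** ?D = Diag c"
    by (simp add: pos_semidef_def)
  fix R :: "real ^ 'a ^ 'a"
  assume R: "pos_semidef R \<and> R ** R = Diag c"
  have "R *v axis i 1 = ?D *v axis i 1" for i
  proof -
    define s where "s = sqrt (c $ i)"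
    have s: "s > 0" "s * s = c $ i"
      using pos[of i] by (simp_all add: s_def)
    define y where "y = R *v axis i 1 - s *\<^sub>R axis i 1"
    have "R *v (R *v axis i 1) = (s * s) *\<^sub>R axis i 1"
    proof -
      have "R *v (R *v axis i 1) = Diag c *v axis i 1"
        using R by (simp add: matrix_vector_mul_assoc)
      then show ?thesis
        using s by (auto simp: Diag_mult_vec vec_eq_iff axis_def)
    qed
    then have "R *v y = - s *\<^sub>R y"
      by (simp add: y_def matrix_vector_mult_diff_distrib matrix_vector_mult_scaleR algebra_simps)
    moreover have "0 \<le> y \<bullet> (R *v y)"
      using R by (simp add: pos_semidef_def)
    ultimately have "s * (y \<bullet> y) \<le> 0"
      by simp
    with s have "y \<bullet> y \<le> 0"
      by (simp add: mult_le_0_iff)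
    then have "y = 0"
      using inner_ge_zero[of y] inner_eq_zero_iff[of y] by linarith
    moreover have "?D *v axis i 1 = s *\<^sub>R axis i 1"
      by (auto simp: Diag_mult_vec vec_eq_iff axis_def s_def)
    ultimately show ?thesis
      by (simp add: y_def)
  qed
  then have "column i R = column i ?D" for i
    by (simp add: matrix_vector_mul_component matrix_vector_mult_basis)
  then show "R = ?D"
    by (simp add: column_def vec_eq_iff)
qed

end

theory Submission
  imports Defs
begin

text \<open>The trace in \<open>\<omega>\<close> is \<open>\<Sum>i. c\<^sub>i d\<^sub>i\<close> with \<open>d = diag (A A\<^sup>T)\<close>, and the determinant is
  \<open>(\<Prod>i. c\<^sub>i) (det A)\<^sup>2\<close>. By AM-GM, the objective is at least
  \<open>((\<Prod>i. d\<^sub>i) / (det A)\<^sup>2) powr (1/n)\<close>, which is attained when all \<open>c\<^sub>i d\<^sub>i\<close> are 1.\<close>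

lemma det_Diag: "det (Diag c) = (\<Prod>i\<in>UNIV. c $ i)"
  by (subst det_diagonal) (simp_all add: Diag_def)

text \<open>\<open>matrix_inv\<close> is a Hilbert choice among two-sided inverses. The explicit
  matrix \<open>?D\<close> shows that the choice exists, and cancelling \<open>Diag c\<close>
  against \<open>?D\<close> identifies the chosen inverse with it.\<close>

lemma matrix_inv_Diag:
  assumes "\<And>i. c $ i \<noteq> 0"
  shows "matrix_inv (Diag c) = Diag (\<chi> i. 1 / c $ i)"
proof -
  let ?D = "Diag (\<chi> i. 1 / c $ i)"
  have "Diag (\<chi> i. 1) = (mat 1 :: real ^ 'a ^ 'a)"
    by (simp add: Diag_def mat_def vec_eq_iff)
  then have D: "Diag c ** ?D = mat 1" "?D ** Diag c = mat 1"
    using assms by (simp_all add: Diag_mult_Diag)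
  have "matrix_inv (Diag c) ** Diag c = mat 1"
    unfolding matrix_inv_def by (rule someI2) (use D in auto)
  then have "matrix_inv (Diag c) ** (Diag c ** ?D) = ?D"
    by (simp add: matrix_mul_assoc)
  then show ?thesis
    by (simp add: D)
qed

lemma diag_mult_transpose_self: "diag (A ** transpose A) $ i = row i A \<bullet> row i A"
  by (simp add: diag_def matrix_matrix_mult_def transpose_def row_def inner_vec_def)

text \<open>The entry is the squared norm of a row of \<open>A\<close>, and a zero row would force
  \<open>det A = 0\<close>.\<close>

lemma diag_mult_transpose_self_pos:
  fixes A :: "real ^ 'n ^ 'n"
  assumes "invertible A"
  shows "0 < diag (A ** transpose A) $ i"
proof -
  have "row i A \<noteq> 0"
    using assms det_zero_row(2)[of i A] by (auto simp: invertible_det_nz row_def)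
  then show ?thesis
    by (simp add: diag_mult_transpose_self)
qed

lemma omega_left_objective_eq:
  fixes A :: "real ^ 'n ^ 'n"
  assumes "c \<in> pos_vecs"
  shows "omega_left_objective A c =
    ((\<Sum>i\<in>UNIV. c $ i * diag (A ** transpose A) $ i) / real CARD('n)) /
    (((\<Prod>i\<in>UNIV. c $ i) * (det A)\<^sup>2) powr (1 / real CARD('n)))"
proof -
  have c: "0 < c $ i" for i
    using assms by (simp add: pos_vecs_def)
  define B where "B = mat_sqrt (Diag c) ** A"
  have D: "mat_sqrt (Diag c) = Diag (\<chi> i. sqrt (c $ i))"
    by (rule mat_sqrt_Diag[OF assms])
  have B: "B $ i $ j = sqrt (c $ i) * A $ i $ j" for i j
    by (simp add: B_def D, simp add: Diag_def matrix_matrix_mult_def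
        if_distrib[of "\<lambda>a. a * _"] cong: if_cong)
  have BB: "B $ i $ j * B $ i $ j = c $ i * (A $ i $ j * A $ i $ j)" for i j
    using c[of i] by (simp add: B power_mult_distrib flip: power2_eq_square)
  \<comment> \<open>Swapping the factors puts the squared norms of the rows of \<open>B\<close> on
    the diagonal. Row \<open>i\<close> of \<open>B\<close> is row \<open>i\<close> of
    \<open>A\<close> scaled by \<open>sqrt (c $ i)\<close>, so each \<open>c $ i\<close> factors
    out.\<close>
  have "trace (transpose B ** B) = trace (B ** transpose B)"
    by (rule trace_mul_sym)
  also have "\<dots> = (\<Sum>i\<in>UNIV. \<Sum>j\<in>UNIV. c $ i * (A $ i $ j * A $ i $ j))"
    by (simp add: trace_def matrix_matrix_mult_def transpose_def BB)
  also have "\<dots> = (\<Sum>i\<in>UNIV. c $ i * diag (A ** transpose A) $ i)"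
    by (simp add: diag_mult_transpose_self inner_vec_def row_def sum_distrib_left)
  finally have tr: "trace (transpose B ** B) = (\<Sum>i\<in>UNIV. c $ i * diag (A ** transpose A) $ i)" .
  have "(\<Prod>i\<in>UNIV. sqrt (c $ i))\<^sup>2 = (\<Prod>i\<in>UNIV. c $ i)"
    using c by (simp add: prod_power_distrib less_imp_le)
  then have "det (transpose B ** B) = (\<Prod>i\<in>UNIV. c $ i) * (det A)\<^sup>2"
    by (simp add: B_def D det_mul det_transpose det_Diag flip: power2_eq_square)
      (simp add: power_mult_distrib)
  with tr show ?thesis
    by (simp add: omega_left_objective_def omega_def B_def)
qed

theorem theorem3p3:
  fixes A :: "real ^ 'n ^ 'n"
  assumes "invertible A"
  shows "omega_optimal_left_diag_precond A (matrix_inv (Diag (diag (A ** transpose A))))"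
proof -
  define d where "d = diag (A ** transpose A)"
  define e where "e = (\<chi> i. 1 / d $ i)"
  have d: "0 < d $ i" for i
    using diag_mult_transpose_self_pos[OF assms] by (simp add: d_def)
  then have e: "e \<in> pos_vecs"
    by (simp add: e_def pos_vecs_def)
  have detA: "0 < (det A)\<^sup>2"
    using assms by (simp add: invertible_det_nz)
  define p where "p = 1 / real CARD('n)"
  let ?m = "((\<Prod>i\<in>UNIV. d $ i) / (det A)\<^sup>2) powr p"
  \<comment> \<open>Every \<open>e $ i * d $ i\<close> is 1, so the sum is the dimension and the
    averaged trace is 1.\<close>
  have "omega_left_objective A e = 1 / (((\<Prod>i\<in>UNIV. 1 / d $ i) * (det A)\<^sup>2) powr p)"
    unfolding omega_left_objective_eq[OF e] d_def[symmetric] p_def[symmetric]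
    using d by (simp add: e_def less_imp_neq[symmetric])
  also have "\<dots> = ?m"
    using d detA by (simp add: prod_dividef powr_divide prod_nonneg less_imp_le)
  finally have min: "omega_left_objective A e = ?m" .
  have "?m \<le> omega_left_objective A c" if c: "c \<in> pos_vecs" for c
  proof -
    have cpos: "0 < c $ i" for i
      using c by (simp add: pos_vecs_def)
    define P where "P = ((\<Prod>i\<in>UNIV. c $ i) * (det A)\<^sup>2) powr p"
    have C: "0 < (\<Prod>i\<in>UNIV. c $ i)"
      using cpos by (simp add: prod_pos)
    have P: "0 < P"
      using C detA unfolding P_def by (metis mult_pos_pos powr_gt_zero less_irrefl)
    \<comment> \<open>Expanding the fraction by the product of the \<open>c $ i\<close> turns its
      denominator into the base of \<open>P\<close>, so that the bound and the objective share the
      divisor \<open>P\<close>. What remains is AM-GM for the numbers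
      \<open>c $ i * d $ i\<close>.\<close>
    have "(\<Prod>i\<in>UNIV. d $ i) / (det A)\<^sup>2
      = (\<Prod>i\<in>UNIV. c $ i * d $ i) / ((\<Prod>i\<in>UNIV. c $ i) * (det A)\<^sup>2)"
      unfolding prod.distrib using C
      by (intro mult_divide_mult_cancel_left[symmetric] less_imp_neq[symmetric])
    then have m: "?m = (\<Prod>i\<in>UNIV. c $ i * d $ i) powr p / P"
      using C cpos d detA
      by (simp only: P_def) (intro powr_divide prod_nonneg; simp add: less_imp_le)
    have "(\<Prod>i\<in>UNIV. c $ i * d $ i) powr p \<le> (\<Sum>i\<in>UNIV. c $ i * d $ i / real CARD('n))"
      unfolding p_def using cpos d by (intro arith_geom_mean) (auto simp: less_imp_le)
    also have "\<dots> = (\<Sum>i\<in>UNIV. c $ i * d $ i) / real CARD('n)"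
      by (simp add: sum_divide_distrib)
    finally have "?m \<le> (\<Sum>i\<in>UNIV. c $ i * d $ i) / real CARD('n) / P"
      using P unfolding m by (intro divide_right_mono) auto
    then show ?thesis
      by (simp add: omega_left_objective_eq[OF c] P_def p_def d_def)
  qed
  \<comment> \<open>\<open>is_arg_min\<close> says that no feasible point has a strictly smaller
    value; in a linear order this is the lower bound \<open>?m\<close> together with its attainment
    at \<open>e\<close>.\<close>
  with e min have "is_arg_min (omega_left_objective A) (\<lambda>c. c \<in> pos_vecs) e"
    by (simp add: is_arg_min_linorder)
  moreover have "matrix_inv (Diag d) = Diag e"
    unfolding e_def using d by (intro matrix_inv_Diag) (simp add: less_imp_neq[symmetric])
  ultimately show ?thesis
    unfolding omega_optimal_left_diag_precond_def d_def by blast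
qed

end
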